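(* Let $\kappa>0$, $\alpha\in\mathbb{R}$ and $(f_0,g_0)\in\mathbb{R}^2$. Then there exist smooth, global in time solutions of the nonlinear resistive MHD equations \begin{align*} \partial_t V + V\cdot\nabla V+\nabla p &= B\cdot\nabla B,\\ \partial_t B + V\cdot\nabla B &= \kappa\Delta B + B\cdot\nabla V,\\ \operatorname{div}(B)=\operatorname{div}(V)&=0, \end{align*} on $\mathbb{R}_+\times\mathbb{T}\times\mathbb{R}$, which are of the form \begin{align*} V(t,x,y)&=(y,0)-\frac{f(t)}{1+t^2}\nabla^\perp\cos(x-ty),\\ B(t,x,y)&=(\alpha,0)+\frac{g(t)}{1+t^2}\nabla^\perp\sin(x-ty), \end{align*} with $(f(0),g(0))=(f_0,g_0)$. Furthermore, for given $c\in\mathbb{R}$ and a suitable choice of $(f_0,g_0)$ (depending on $c$) it holds that $$f(t)\to 2c,\qquad g(t)\to 0\qquad\text{as } t\to\infty.$$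
   Context: Here $\nabla^\perp=(-\partial_y,\partial_x)$, and $f,g:[0,\infty)\to\mathbb{R}$ are functions of time only. *)

theory Defs
  imports "HOL-Analysis.Analysis"
begin

text \<open>
  \<open>C\<^sup>k\<close> regularity on a set that may include boundary points: derivatives are taken within \<open>S\<close>,
  hence one-sided at the boundary, and are continuous up to it.  On \<open>[0,\<infinity>) \<times> \<real>\<^sup>2\<close>, the only kind
  of set used below, derivatives within the set are unique, so the existential quantifier picks
  out the derivative.  In finite dimension a derivative is \<open>C\<^sup>k\<close> iff all its directional
  components are.
\<close>

primrec Ck_on :: "nat \<Rightarrow> 'a::euclidean_space set \<Rightarrow> ('a \<Rightarrow> 'b::real_normed_vector) \<Rightarrow> bool" where
  "Ck_on 0 S u \<longleftrightarrow> continuous_on S u"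
| "Ck_on (Suc k) S u \<longleftrightarrow>
     (\<exists>u'. (\<forall>z\<in>S. (u has_derivative u' z) (at z within S)) \<and> (\<forall>v. Ck_on k S (\<lambda>z. u' z v)))"

definition smooth_on :: "'a::euclidean_space set \<Rightarrow> ('a \<Rightarrow> 'b::real_normed_vector) \<Rightarrow> bool" where
  "smooth_on S u \<longleftrightarrow> (\<forall>k. Ck_on k S u)"

text \<open>
  Fields on \<open>\<T> \<times> \<real>\<close> with \<open>\<T> = \<real> / 2\<pi>\<int>\<close> are functions of \<open>(x, y) \<in> \<real>\<^sup>2\<close> that are \<open>2\<pi>\<close>-periodic
  in \<open>x\<close>.
\<close>

definition periodic_x :: "(real \<times> real \<Rightarrow> 'a) \<Rightarrow> bool" where
  "periodic_x u \<longleftrightarrow> (\<forall>x y. u (x + 2 * pi, y) = u (x, y))"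

definition partial_x :: "(real \<times> real \<Rightarrow> 'a::real_normed_vector) \<Rightarrow> real \<times> real \<Rightarrow> 'a" where
  "partial_x u = (\<lambda>(x, y). vector_derivative (\<lambda>s. u (s, y)) (at x))"

definition partial_y :: "(real \<times> real \<Rightarrow> 'a::real_normed_vector) \<Rightarrow> real \<times> real \<Rightarrow> 'a" where
  "partial_y u = (\<lambda>(x, y). vector_derivative (\<lambda>s. u (x, s)) (at y))"

text \<open>The time derivative on \<open>[0,\<infinity>)\<close> is one-sided at \<open>t = 0\<close>.\<close>

definition partial_t ::
    "(real \<Rightarrow> real \<times> real \<Rightarrow> 'a::real_normed_vector) \<Rightarrow> real \<Rightarrow> real \<times> real \<Rightarrow> 'a" where
  "partial_t u t z = vector_derivative (\<lambda>s. u s z) (at t within {0..})"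

definition grad :: "(real \<times> real \<Rightarrow> real) \<Rightarrow> real \<times> real \<Rightarrow> real \<times> real" where
  "grad u z = (partial_x u z, partial_y u z)"

definition perp_grad :: "(real \<times> real \<Rightarrow> real) \<Rightarrow> real \<times> real \<Rightarrow> real \<times> real" where
  "perp_grad u z = (- partial_y u z, partial_x u z)"

definition divergence :: "(real \<times> real \<Rightarrow> real \<times> real) \<Rightarrow> real \<times> real \<Rightarrow> real" where
  "divergence U z = partial_x (\<lambda>w. fst (U w)) z + partial_y (\<lambda>w. snd (U w)) z"

definition laplacian :: "(real \<times> real \<Rightarrow> 'a::real_normed_vector) \<Rightarrow> real \<times> real \<Rightarrow> 'a" where
  "laplacian u z = partial_x (partial_x u) z + partial_y (partial_y u) z"

definition advect ::
    "(real \<times> real \<Rightarrow> real \<times> real) \<Rightarrow> (real \<times> real \<Rightarrow> 'a::real_normed_vector) \<Rightarrow> real \<times> real \<Rightarrow> 'a" where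
  "advect U u z = fst (U z) *\<^sub>R partial_x u z + snd (U z) *\<^sub>R partial_y u z"

definition smooth_global_mhd_solution ::
    "real \<Rightarrow> (real \<Rightarrow> real \<times> real \<Rightarrow> real \<times> real) \<Rightarrow> (real \<Rightarrow> real \<times> real \<Rightarrow> real \<times> real)
      \<Rightarrow> (real \<Rightarrow> real \<times> real \<Rightarrow> real) \<Rightarrow> bool" where
  "smooth_global_mhd_solution \<kappa> V B p \<longleftrightarrow>
     smooth_on ({0..} \<times> UNIV) (\<lambda>(t, z). V t z) \<and>
     smooth_on ({0..} \<times> UNIV) (\<lambda>(t, z). B t z) \<and>
     smooth_on ({0..} \<times> UNIV) (\<lambda>(t, z). p t z) \<and>
     (\<forall>t\<ge>0. periodic_x (V t) \<and> periodic_x (B t) \<and> periodic_x (p t)) \<and>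
     (\<forall>t\<ge>0. \<forall>z.
        partial_t V t z + advect (V t) (V t) z + grad (p t) z = advect (B t) (B t) z \<and>
        partial_t B t z + advect (V t) (B t) z
          = \<kappa> *\<^sub>R laplacian (B t) z + advect (B t) (V t) z \<and>
        divergence (B t) z = 0 \<and> divergence (V t) z = 0)"

definition wave_velocity :: "(real \<Rightarrow> real) \<Rightarrow> real \<Rightarrow> real \<times> real \<Rightarrow> real \<times> real" where
  "wave_velocity f t = (\<lambda>(x, y).
     (y, 0) - (f t / (1 + t\<^sup>2)) *\<^sub>R perp_grad (\<lambda>(x, y). cos (x - t * y)) (x, y))"

definition wave_magnetic :: "real \<Rightarrow> (real \<Rightarrow> real) \<Rightarrow> real \<Rightarrow> real \<times> real \<Rightarrow> real \<times> real" where
  "wave_magnetic \<alpha> g t = (\<lambda>(x, y).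
     (\<alpha>, 0) + (g t / (1 + t\<^sup>2)) *\<^sub>R perp_grad (\<lambda>(x, y). sin (x - t * y)) (x, y))"

end

theory Submission
  imports Defs
begin

text \<open>
  All nonlinear self-interactions of the waves vanish, since \<open>(t, 1)\<close> is orthogonal to the gradient
  \<open>(1, - t)\<close> of the phase \<open>x - t y\<close>.  The equations therefore reduce to the linear system
  \<open>f' = - \<alpha> g\<close>, \<open>g' = \<alpha> f + (2 t / (1 + t\<^sup>2) - \<kappa> (1 + t\<^sup>2)) g\<close>, which has global solutions.  The strong
  damping of \<open>g\<close> forces \<open>g \<longlongrightarrow> 0\<close> and makes \<open>f\<close> converge; the limit is nonzero for data
  \<open>(f, g) = (1, 0)\<close> prescribed at a large time \<open>T\<close>.  The nonvanishing Wronskian transports these data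
  back to time \<open>0\<close>, and scaling produces every limit.
\<close>

section \<open>Linear differential equations on the half-line, and monotone limits\<close>

lemma at_within_Icc_eq_Ici:
  fixes x :: real
  assumes "x < b"
  shows "at x within {a..b} = at x within {a..}"
  using assms by (intro at_within_nhd[where S="{..<b}"]) auto

text \<open>The Picard series converges on the whole half-line: on [0, N] a bound \<open>K\<close>
  for \<open>A\<close> gives the majorants \<open>norm x0 * (K * t) ^ n / fact n\<close> of an
  exponential series, and the same majorants justify differentiating term by term.\<close>

lemma linear_ode_solution_exists:
  fixes A :: "real \<Rightarrow> 'a::banach \<Rightarrow>\<^sub>L 'a" and x0 :: 'a
  assumes cont: "continuous_on {0..} A"
  obtains x where "x 0 = x0"
    "\<And>t. t \<ge> 0 \<Longrightarrow> (x has_vector_derivative blinfun_apply (A t) (x t)) (at t within {0..})"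
proof -
  \<comment> \<open>terms of the Picard series\<close>
  define X where "X = rec_nat (\<lambda>_. x0) (\<lambda>_ u t. integral {0..t} (\<lambda>s. blinfun_apply (A s) (u s)))"
  have X0: "X 0 = (\<lambda>_. x0)"
    and XS: "X (Suc n) = (\<lambda>t. integral {0..t} (\<lambda>s. blinfun_apply (A s) (X n s)))" for n
    by (simp_all add: X_def)
  \<comment> \<open>\<open>D n\<close> is the derivative of \<open>X n\<close>. The first term is
    constant, so \<open>D 0\<close> vanishes and the index is shifted by one.\<close>
  define D where "D = (\<lambda>n t. case n of 0 \<Rightarrow> 0 | Suc k \<Rightarrow> blinfun_apply (A t) (X k t))"
  have contN: "continuous_on {0..N} A" for N
    using cont by (rule continuous_on_subset) auto
  have der: "t \<in> {0..N} \<Longrightarrow> (X n has_vector_derivative D n t) (at t within {0..N})" for n t N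
  proof (induction n arbitrary: t)
    case 0
    then show ?case by (simp add: X0 D_def)
  next
    case (Suc n)
    have "continuous_on {0..N} (X n)"
      unfolding continuous_on_eq_continuous_within
      using Suc.IH has_vector_derivative_continuous by blast
    then have "continuous_on {0..N} (\<lambda>s. blinfun_apply (A s) (X n s))"
      by (intro continuous_intros contN)
    then show ?case
      unfolding XS D_def nat.case using Suc.prems by (rule integral_has_vector_derivative)
  qed
  define x where "x t = (\<Sum>n. X n t)" for t
  \<comment> \<open>The sum \<open>x\<close> does not depend on \<open>N\<close>, so the solutions
    on the intervals [0, N] need no gluing.\<close>
  have main: "x 0 = x0 \<and>
    (\<forall>t\<in>{0..N}. (x has_vector_derivative blinfun_apply (A t) (x t)) (at t within {0..N}))"
    if N: "N > 0" for N
  proof -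
    have "compact (A ` {0..N})"
      by (intro compact_continuous_image contN compact_Icc)
    then obtain K where "K > 0" and K: "\<And>t. t \<in> {0..N} \<Longrightarrow> norm (A t) \<le> K"
      by (metis bounded_pos compact_imp_bounded image_eqI)
    have Abound: "norm (blinfun_apply (A t) v) \<le> K * norm v" if "t \<in> {0..N}" for t v
      using norm_blinfun[of "A t" v] K[OF that]
      by (meson mult_right_mono norm_ge_zero order_trans)
    have bound: "norm (X n t) \<le> norm x0 * (K * t) ^ n / fact n" if "t \<in> {0..N}" for n t
      using that
    proof (induction n arbitrary: t)
      case 0
      then show ?case by (simp add: X0)
    next
      case (Suc n)
      show ?case
      proof (cases "t = 0")
        case True
        then show ?thesis by (simp add: XS)
      next
        case False
        with Suc.prems have t: "0 < t" "t \<le> N" by auto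
        \<comment> \<open>The derivative of this majorant is \<open>K\<close> times the majorant of
          the previous term, so the mean value inequality carries the bound from \<open>n\<close> to
          \<open>Suc n\<close>.\<close>
        let ?\<phi> = "\<lambda>t. norm x0 * (K * t) ^ Suc n / fact (Suc n)"
        have d: "s \<in> {0..t} \<Longrightarrow> (X (Suc n) has_vector_derivative D (Suc n) s) (at s within {0..t})" for s
          by (rule der)
        have "norm (X (Suc n) t - X (Suc n) 0) \<le> ?\<phi> t - ?\<phi> 0"
        proof (rule differentiable_bound_general[OF t(1)])
          show "continuous_on {0..t} (X (Suc n))"
            unfolding continuous_on_eq_continuous_within
            using d has_vector_derivative_continuous by blast
          show "continuous_on {0..t} ?\<phi>" by (intro continuous_intros) auto
          fix s assume s: "0 < s" "s < t"
          then show "(X (Suc n) has_vector_derivative D (Suc n) s) (at s)"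
            using d[of s] at_within_interior[of s "{0..t}"] by simp
          show "(?\<phi> has_vector_derivative K * (norm x0 * (K * s) ^ n / fact n)) (at s)"
            unfolding has_real_derivative_iff_has_vector_derivative[symmetric]
            by (rule derivative_eq_intros refl | simp add: divide_simps)+
          show "norm (D (Suc n) s) \<le> K * (norm x0 * (K * s) ^ n / fact n)"
            using order_trans[OF Abound[of s "X n s"] mult_left_mono[OF Suc.IH[of s], of K]]
              s t \<open>K > 0\<close>
            by (simp add: D_def)
        qed
        then show ?thesis by (simp add: XS)
      qed
    qed
    have expsum: "summable (\<lambda>n. norm x0 * (K * N) ^ n / fact n)"
      using summable_mult[OF summable_exp[of "K * N"], of "norm x0"]
      by (simp add: field_simps)
    have boundN: "norm (X n t) \<le> norm x0 * (K * N) ^ n / fact n" if "t \<in> {0..N}" for n t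
      using bound[OF that, of n] that \<open>K > 0\<close>
      by (elim order_trans) (intro divide_right_mono mult_left_mono power_mono, auto)
    have summX: "summable (\<lambda>n. X n t)" if "t \<in> {0..N}" for t
      using boundN[OF that] by (intro summable_comparison_test[OF _ expsum]) auto
    have sumsD: "(\<lambda>n. D n t) sums blinfun_apply (A t) (x t)" if "t \<in> {0..N}" for t
    proof -
      have "(\<lambda>n. D (Suc n) t) sums blinfun_apply (A t) (x t)"
        unfolding D_def nat.case x_def
        by (intro bounded_linear.sums[OF blinfun.bounded_linear_right] summable_sums summX that)
      then show ?thesis
        by (subst (asm) sums_Suc_iff) (simp add: D_def)
    qed
    \<comment> \<open>Differentiating the series needs uniform convergence of the derivatives; the
      M-test applies with majorants shifted in the same way as \<open>D\<close>.\<close>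
    have unif: "uniform_limit {0..N} (\<lambda>n t. \<Sum>i<n. D i t) (\<lambda>t. blinfun_apply (A t) (x t)) sequentially"
    proof -
      define M where "M = (\<lambda>n. case n of 0 \<Rightarrow> 0 | Suc k \<Rightarrow> K * (norm x0 * (K * N) ^ k / fact k))"
      have "summable M"
        by (subst summable_Suc_iff[symmetric]) (simp add: M_def summable_mult[OF expsum, of K, simplified])
      moreover have "norm (D n t) \<le> M n" if "t \<in> {0..N}" for n t
        using order_trans[OF Abound[OF that, of "X (n-1) t"]
            mult_left_mono[OF boundN[OF that, of "n-1"], of K]] \<open>K > 0\<close>
        by (cases n) (simp_all add: D_def M_def)
      ultimately have "uniform_limit {0..N} (\<lambda>n t. \<Sum>i<n. D i t) (\<lambda>t. suminf (\<lambda>n. D n t)) sequentially"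
        by (intro Weierstrass_m_test) auto
      then show ?thesis
        by (rule uniform_limit_cong'[THEN iffD1, rotated 2]) (auto simp: sums_unique[OF sumsD])
    qed
    have "\<exists>g. \<forall>t\<in>{0..N}. (\<lambda>n. X n t) sums g t \<and>
        (g has_derivative (\<lambda>h. h *\<^sub>R blinfun_apply (A t) (x t))) (at t within {0..N})"
    proof (rule has_derivative_series[where f'="\<lambda>n t h. h *\<^sub>R D n t" and x=0])
      show "(\<lambda>n. X n 0) sums x 0" using summX[of 0] N by (simp add: x_def summable_sums)
      show "(X n has_derivative (\<lambda>h. h *\<^sub>R D n t)) (at t within {0..N})" if "t \<in> {0..N}" for n t
        using der[OF that] by (simp add: has_vector_derivative_def)
      fix e :: real assume "e > 0"
      show "\<forall>\<^sub>F n in sequentially. \<forall>t\<in>{0..N}. \<forall>h.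
          norm ((\<Sum>i<n. h *\<^sub>R D i t) - h *\<^sub>R blinfun_apply (A t) (x t)) \<le> e * norm h"
        using uniform_limitD[OF unif \<open>e > 0\<close>]
      proof eventually_elim
        case (elim n)
        show ?case
        proof (intro ballI allI)
          fix t h assume "t \<in> {0..N}"
          with elim have "norm ((\<Sum>i<n. D i t) - blinfun_apply (A t) (x t)) \<le> e"
            by (auto simp: dist_norm less_imp_le)
          then show "norm ((\<Sum>i<n. h *\<^sub>R D i t) - h *\<^sub>R blinfun_apply (A t) (x t)) \<le> e * norm h"
            using mult_left_mono[of _ e "\<bar>h\<bar>"]
            by (simp add: mult.commute[of e] flip: scaleR_sum_right scaleR_diff_right)
        qed
      qed
    qed (use N in auto)
    \<comment> \<open>Termwise differentiation yields some sum \<open>g\<close>; uniqueness of sums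
      identifies it with \<open>x\<close>.\<close>
    then obtain g where g: "\<And>t. t \<in> {0..N} \<Longrightarrow> (\<lambda>n. X n t) sums g t"
      "\<And>t. t \<in> {0..N} \<Longrightarrow>
        (g has_vector_derivative blinfun_apply (A t) (x t)) (at t within {0..N})"
      unfolding has_vector_derivative_def by blast
    have gx: "g t = x t" if "t \<in> {0..N}" for t
      using sums_unique[OF g(1)[OF that]] by (simp add: x_def)
    have "(\<lambda>n. X n 0) sums x0"
      using sums_single[of 0 "\<lambda>_. x0"]
      by (rule sums_cong[THEN iffD1, rotated]) (auto simp: X0 XS gr0_conv_Suc)
    then have "x 0 = x0" by (simp add: x_def sums_iff)
    moreover have "(x has_vector_derivative blinfun_apply (A t) (x t)) (at t within {0..N})"
      if "t \<in> {0..N}" for t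
      using g(2)[OF that] by (rule has_vector_derivative_transform[OF that, rotated]) (simp add: gx)
    ultimately show ?thesis by blast
  qed
  show thesis
  proof
    show "x 0 = x0" using main[of 1] by simp
    \<comment> \<open>Since \<open>t\<close> lies strictly below \<open>t + 1\<close>, the
      derivative within [0, t + 1] is the one within the half-line.\<close>
    show "(x has_vector_derivative blinfun_apply (A t) (x t)) (at t within {0..})" if "t \<ge> 0" for t
      using main[of "t + 1"] that by (auto simp flip: at_within_Icc_eq_Ici[of t "t + 1" 0])
  qed
qed

lemma increasing_bounded_tendsto_at_top:
  fixes h :: "real \<Rightarrow> real"
  assumes mono: "\<And>s t. T \<le> s \<Longrightarrow> s \<le> t \<Longrightarrow> h s \<le> h t" and bd: "\<And>t. T \<le> t \<Longrightarrow> h t \<le> M"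
  obtains L where "(h \<longlongrightarrow> L) at_top"
proof -
  \<comment> \<open>Freezing \<open>h\<close> to the left of \<open>T\<close> makes it monotone on
    the whole line, so convergence along the integers suffices.\<close>
  define k where "k t = h (max T t)" for t
  have "mono k" by (auto simp: k_def intro!: monoI mono)
  moreover from this have "incseq (\<lambda>n. k (real n))" by (simp add: mono_def)
  then obtain L where "(\<lambda>n. k (real n)) \<longlonglongrightarrow> L"
    by (rule incseq_convergent[where B=M]) (auto simp: k_def intro: bd)
  ultimately have "(k \<longlongrightarrow> L) at_top" by (rule tendsto_at_topI_sequentially_real)
  moreover have "\<forall>\<^sub>F t in at_top. k t = h t"
    using eventually_ge_at_top[of T] by eventually_elim (simp add: k_def max_absorb2)
  ultimately have "(h \<longlongrightarrow> L) at_top" by (metis tendsto_cong)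
  then show thesis by (rule that)
qed

section \<open>The linear system for the amplitudes: existence, Wronskian and asymptotics\<close>

text \<open>The resistive term acts on the phase \<open>x - t * y\<close> as multiplication by
  \<open>- \<kappa> * (1 + t\<^sup>2)\<close>; the first summand comes from the weight
  \<open>1 / (1 + t\<^sup>2)\<close> that multiplies \<open>g\<close> in the magnetic field.\<close>

definition damping :: "real \<Rightarrow> real \<Rightarrow> real" where
  "damping \<kappa> t = 2 * t / (1 + t\<^sup>2) - \<kappa> * (1 + t\<^sup>2)"

definition wave_system :: "real \<Rightarrow> real \<Rightarrow> (real \<Rightarrow> real) \<Rightarrow> (real \<Rightarrow> real) \<Rightarrow> bool" where
  "wave_system \<kappa> \<alpha> f g \<longleftrightarrow> (\<forall>t\<ge>0.
     (f has_real_derivative - \<alpha> * g t) (at t within {0..}) \<and>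
     (g has_real_derivative \<alpha> * f t + damping \<kappa> t * g t) (at t within {0..}))"

lemma one_plus_square_neq_0 [simp]: "1 + x\<^sup>2 \<noteq> (0::real)"
  by (metis add_pos_nonneg less_irrefl zero_le_power2 zero_less_one)

text \<open>The growth term is at most 1, which half of \<open>\<kappa> * t\<^sup>2\<close> absorbs;
  the other half remains as damping.\<close>

lemma damping_le:
  assumes "\<kappa> * t\<^sup>2 \<ge> 2"
  shows "damping \<kappa> t \<le> - (\<kappa> * t\<^sup>2 / 2)"
proof -
  have "\<kappa> > 0" using assms by (smt (verit) mult_nonpos_nonneg zero_le_power2)
  have "2 * t \<le> 1 + t\<^sup>2" using zero_le_power2[of "t - 1"] by (simp add: power2_diff)
  then have "2 * t / (1 + t\<^sup>2) \<le> 1" by (simp add: divide_le_eq add_pos_nonneg)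
  then show ?thesis using assms \<open>\<kappa> > 0\<close> by (simp add: damping_def algebra_simps)
qed

lemma wave_system_exists:
  obtains f g where "wave_system \<kappa> \<alpha> f g" "f 0 = f0" "g 0 = g0"
proof -
  \<comment> \<open>The coefficient operator is a constant skew part \<open>R\<close> plus
    \<open>damping\<close> times the projection \<open>P\<close> onto the second component, so its
    continuity reduces to that of \<open>damping\<close>.\<close>
  define R where "R = Blinfun (\<lambda>(a, b). (- \<alpha> * b, \<alpha> * a) :: real \<times> real)"
  define P where "P = Blinfun (\<lambda>(a :: real, b). (0, b) :: real \<times> real)"
  have R: "blinfun_apply R = (\<lambda>(a, b). (- \<alpha> * b, \<alpha> * a))"
    unfolding R_def case_prod_beta
    by (intro bounded_linear_Blinfun_apply bounded_linear_Pair bounded_linear_const_mult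
        bounded_linear_fst bounded_linear_snd)
  have P: "blinfun_apply P = (\<lambda>(a, b). (0, b))"
    unfolding P_def case_prod_beta
    by (intro bounded_linear_Blinfun_apply bounded_linear_Pair bounded_linear_zero bounded_linear_snd)
  have "continuous_on {0..} (\<lambda>t. R + damping \<kappa> t *\<^sub>R P)"
    unfolding damping_def by (intro continuous_intros) auto
  then obtain u where u0: "u 0 = (f0, g0)" and
    u: "\<And>t. t \<ge> 0 \<Longrightarrow> (u has_vector_derivative blinfun_apply (R + damping \<kappa> t *\<^sub>R P) (u t)) (at t within {0..})"
    using linear_ode_solution_exists[of "\<lambda>t. R + damping \<kappa> t *\<^sub>R P" "(f0, g0)"] by metis
  show thesis
  proof (rule that[of "\<lambda>t. fst (u t)" "\<lambda>t. snd (u t)"])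
    show "wave_system \<kappa> \<alpha> (\<lambda>t. fst (u t)) (\<lambda>t. snd (u t))"
      unfolding wave_system_def has_real_derivative_iff_has_vector_derivative
      using bounded_linear.has_vector_derivative[OF bounded_linear_fst u]
        bounded_linear.has_vector_derivative[OF bounded_linear_snd u]
      by (auto simp: plus_blinfun.rep_eq scaleR_blinfun.rep_eq R P case_prod_beta)
  qed (simp_all add: u0)
qed

lemma wave_system_combination:
  assumes "wave_system \<kappa> \<alpha> f1 g1" "wave_system \<kappa> \<alpha> f2 g2"
  shows "wave_system \<kappa> \<alpha> (\<lambda>t. a * f1 t + b * f2 t) (\<lambda>t. a * g1 t + b * g2 t)"
  unfolding wave_system_def
proof (intro allI impI conjI)
  fix t :: real assume "t \<ge> 0"
  note d [derivative_intros] = assms[unfolded wave_system_def, rule_format, OF this]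
  show "((\<lambda>t. a * f1 t + b * f2 t) has_real_derivative - \<alpha> * (a * g1 t + b * g2 t)) (at t within {0..})"
    by (rule derivative_eq_intros d[THEN conjunct1] refl)+ (simp add: algebra_simps)
  show "((\<lambda>t. a * g1 t + b * g2 t) has_real_derivative
      \<alpha> * (a * f1 t + b * f2 t) + damping \<kappa> t * (a * g1 t + b * g2 t)) (at t within {0..})"
    by (rule derivative_eq_intros d[THEN conjunct2] refl)+ (simp add: algebra_simps)
qed

text \<open>This is Liouville's formula. The trace of the system is \<open>damping\<close>, so the
  Wronskian solves W' = \<open>damping\<close> W. The factor \<open>M\<close> is the exponential of
  minus a primitive of \<open>damping\<close>, and the product \<open>Z\<close> is therefore
  constant.\<close>

lemma wronskian_nonzero:
  assumes "wave_system \<kappa> \<alpha> f1 g1" "wave_system \<kappa> \<alpha> f2 g2"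
    and "f1 0 * g2 0 - f2 0 * g1 0 \<noteq> 0" and "t \<ge> 0"
  shows "f1 t * g2 t - f2 t * g1 t \<noteq> 0"
proof -
  define M where "M t = exp (\<kappa> * (t + t ^ 3 / 3)) / (1 + t\<^sup>2)" for t :: real
  define Z where "Z t = (f1 t * g2 t - f2 t * g1 t) * M t" for t
  have dM: "(M has_real_derivative - damping \<kappa> s * M s) (at s within {0..})" for s
  proof -
    have "(M has_real_derivative (exp (\<kappa> * (s + s ^ 3 / 3)) * (\<kappa> * (1 + s\<^sup>2)) * (1 + s\<^sup>2)
        - exp (\<kappa> * (s + s ^ 3 / 3)) * (2 * s)) / ((1 + s\<^sup>2) * (1 + s\<^sup>2))) (at s within {0..})"
      unfolding M_def by (rule derivative_eq_intros one_plus_square_neq_0 refl | simp)+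
    moreover have "(e * (\<kappa> * w) * w - e * (2 * s)) / (w * w) = - (2 * s / w - \<kappa> * w) * (e / w)"
      if "w \<noteq> 0" for e w :: real
      using that by (simp add: field_simps)
    ultimately show ?thesis by (simp add: M_def damping_def)
  qed
  have "(Z has_real_derivative 0) (at s within {0..})" if "s \<in> {0..}" for s
  proof -
    from that have "s \<ge> 0" by simp
    note d = assms(1,2)[unfolded wave_system_def, rule_format, OF this]
    show ?thesis
      unfolding Z_def
      by (rule derivative_eq_intros d[THEN conjunct1] d[THEN conjunct2] dM refl)+
        (simp add: algebra_simps)
  qed
  then have "\<exists>c. \<forall>s\<in>{0..}. Z s = c" by (intro has_field_derivative_zero_constant) auto
  then have "Z t = Z 0" using \<open>t \<ge> 0\<close> by auto
  then show ?thesis using assms(3) by (auto simp: Z_def M_def)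
qed

text \<open>
  The energy \<open>f\<^sup>2 + g\<^sup>2\<close> dissipates at rate \<open>\<kappa> t\<^sup>2 g\<^sup>2\<close>, which by AM-GM absorbs \<open>f' = - \<alpha> g\<close> up to an
  error of order \<open>1 / t\<^sup>2\<close>.  So \<open>f - (f\<^sup>2 + g\<^sup>2) / 4 - \<alpha>\<^sup>2 / (\<kappa> t)\<close> is increasing.
\<close>

lemma wave_system_asymptotics:
  assumes sys: "wave_system \<kappa> \<alpha> f g" and T: "T > 0" "\<kappa> * T\<^sup>2 \<ge> 2"
  obtains L where "(f \<longlongrightarrow> L) at_top" "(g \<longlongrightarrow> 0) at_top"
    "L \<ge> f T - ((f T)\<^sup>2 + (g T)\<^sup>2) / 4 - \<alpha>\<^sup>2 / (\<kappa> * T)"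
proof -
  have "\<kappa> > 0" using T by (smt (verit) mult_nonpos_nonneg zero_le_power2)
  have kt: "\<kappa> * t\<^sup>2 \<ge> 2" if "t \<ge> T" for t
    using T \<open>\<kappa> > 0\<close> that by (smt (verit) mult_left_mono power_mono)
  define E where "E t = (f t)\<^sup>2 + (g t)\<^sup>2" for t
  define H where "H t = f t - E t / 4 - \<alpha>\<^sup>2 / (\<kappa> * t)" for t
  have df: "(f has_real_derivative - \<alpha> * g t) (at t)"
    and dg: "(g has_real_derivative \<alpha> * f t + damping \<kappa> t * g t) (at t)" if "t \<ge> T" for t
  proof -
    have "t \<ge> 0" "at t within {0..} = at t"
      using T that at_within_interior[of t "{0..}"] by auto
    then show "(f has_real_derivative - \<alpha> * g t) (at t)"
      "(g has_real_derivative \<alpha> * f t + damping \<kappa> t * g t) (at t)"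
      using sys unfolding wave_system_def by metis+
  qed
  \<comment> \<open>The coupling through \<alpha> is skew, so its cross terms cancel and only the
    damping of \<open>g\<close> changes the energy.\<close>
  have dE: "(E has_real_derivative 2 * damping \<kappa> t * (g t)\<^sup>2) (at t)" if "t \<ge> T" for t
    unfolding E_def
    by (rule derivative_eq_intros df[OF that] dg[OF that] refl)+
      (simp add: algebra_simps power2_eq_square)
  have dH: "(H has_real_derivative - \<alpha> * g t - damping \<kappa> t * (g t)\<^sup>2 / 2 + \<alpha>\<^sup>2 / (\<kappa> * t\<^sup>2)) (at t)"
    if "t \<ge> T" for t
    unfolding H_def using that T \<open>\<kappa> > 0\<close>
    by - (rule derivative_eq_intros df[OF that] dE[OF that] refl | simp add: power2_eq_square mult_ac)+
  have E_rate: "2 * damping \<kappa> t * (g t)\<^sup>2 \<le> - (\<kappa> * t\<^sup>2) * (g t)\<^sup>2" if "t \<ge> T" for t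
    using mult_right_mono[OF damping_le[OF kt[OF that]], of "(g t)\<^sup>2"] by simp
  have E_decreasing: "E t \<le> E s" if "T \<le> s" "s \<le> t" for s t
  proof (rule DERIV_nonpos_imp_nonincreasing[OF that(2)])
    fix r assume "s \<le> r" "r \<le> t"
    then have "T \<le> r" using that by simp
    moreover have "- (\<kappa> * r\<^sup>2) * (g r)\<^sup>2 \<le> 0" using \<open>\<kappa> > 0\<close> by simp
    ultimately show "\<exists>y. (E has_real_derivative y) (at r) \<and> y \<le> 0"
      using dE E_rate by (meson order_trans)
  qed
  have H_increasing: "H s \<le> H t" if "T \<le> s" "s \<le> t" for s t
  proof (rule DERIV_nonneg_imp_nondecreasing[OF that(2)])
    fix r assume "s \<le> r" "r \<le> t"
    then have r: "T \<le> r" "r > 0" using that T by auto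
    \<comment> \<open>With this \<open>n\<close> the Young inequality is a completed square, and
      \<open>2 * n = \<kappa> * r\<^sup>2\<close> makes its error term exactly the derivative of
      \<open>- \<alpha>\<^sup>2 / (\<kappa> * r)\<close>.\<close>
    define n where "n = \<kappa> * r\<^sup>2 / 2"
    have "n > 0" using \<open>\<kappa> > 0\<close> r by (simp add: n_def)
    have "0 \<le> (n * g r - \<alpha>)\<^sup>2 / (2 * n)" using \<open>n > 0\<close> by simp
    also have "\<dots> = - \<alpha> * g r + n * (g r)\<^sup>2 / 2 + \<alpha>\<^sup>2 / (2 * n)"
      using \<open>n > 0\<close> by (simp add: field_simps power2_eq_square)
    also have "\<dots> \<le> - \<alpha> * g r - damping \<kappa> r * (g r)\<^sup>2 / 2 + \<alpha>\<^sup>2 / (\<kappa> * r\<^sup>2)"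
      using E_rate[OF r(1)] by (simp add: n_def)
    finally show "\<exists>y. (H has_real_derivative y) (at r) \<and> y \<ge> 0"
      using dH[OF r(1)] by blast
  qed
  have H_le: "H t \<le> f t" if "t \<ge> T" for t
  proof -
    have "E t \<ge> 0" "\<alpha>\<^sup>2 / (\<kappa> * t) \<ge> 0" using that T \<open>\<kappa> > 0\<close> by (simp_all add: E_def)
    then show ?thesis by (simp add: H_def)
  qed
  \<comment> \<open>The decreasing energy bounds \<open>f\<close> from above, hence also
    \<open>H\<close>.\<close>
  have "H t \<le> 1 + E T" if "t \<ge> T" for t
  proof -
    have "f t \<le> 1 + (f t)\<^sup>2"
    proof -
      have "2 * f t \<le> 1 + (f t)\<^sup>2"
        using zero_le_power2[of "f t - 1"] by (simp add: power2_diff)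
      moreover have "0 \<le> (f t)\<^sup>2" by simp
      ultimately show ?thesis by linarith
    qed
    also have "\<dots> \<le> 1 + E t" by (simp add: E_def)
    also have "\<dots> \<le> 1 + E T" using E_decreasing that by simp
    finally show ?thesis using H_le[OF that] by simp
  qed
  then obtain l where l: "(H \<longlongrightarrow> l) at_top"
    using increasing_bounded_tendsto_at_top[of T H] H_increasing by metis
  obtain e where "((\<lambda>t. - E t) \<longlongrightarrow> e) at_top"
  proof (rule increasing_bounded_tendsto_at_top)
    show "- E s \<le> - E t" if "T \<le> s" "s \<le> t" for s t using E_decreasing[OF that] by simp
    show "- E t \<le> 0" for t by (simp add: E_def)
  qed
  then have e: "(E \<longlongrightarrow> - e) at_top"
    using tendsto_minus_cancel_left by fastforce
  \<comment> \<open>The energy tends to \<open>- e\<close>, and \<open>f\<close> is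
    \<open>H + E / 4\<close> plus a vanishing term, so it converges too; \<open>L\<close> is written
    as the sum of the three limits.\<close>
  define L where "L = l + (- e) / 4 + 0"
  have "((\<lambda>t. \<alpha>\<^sup>2 / (\<kappa> * t)) \<longlongrightarrow> 0) at_top"
    using \<open>\<kappa> > 0\<close>
    by (intro tendsto_divide_0[OF tendsto_const] filterlim_at_top_imp_at_infinity
        filterlim_tendsto_pos_mult_at_top[OF tendsto_const] filterlim_ident)
  then have "((\<lambda>t. H t + E t / 4 + \<alpha>\<^sup>2 / (\<kappa> * t)) \<longlongrightarrow> L) at_top"
    unfolding L_def by (intro tendsto_add l tendsto_divide e tendsto_const) simp_all
  then have fL: "(f \<longlongrightarrow> L) at_top" by (simp add: H_def)
  define q where "q = - e - L\<^sup>2"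
  have "((\<lambda>t. E t - (f t)\<^sup>2) \<longlongrightarrow> q) at_top"
    unfolding q_def by (intro tendsto_intros e fL)
  then have gq: "((\<lambda>t. (g t)\<^sup>2) \<longlongrightarrow> q) at_top" by (simp add: E_def)
  \<comment> \<open>The limit \<open>q\<close> of \<open>(g t)\<^sup>2\<close> exists because those
    of \<open>E\<close> and \<open>f\<close> do. Were it positive, the energy would eventually fall
    at rate at least \<open>q\<close> and become negative.\<close>
  have "q = 0"
  proof (rule ccontr)
    assume "q \<noteq> 0"
    moreover have "q \<ge> 0" by (rule tendsto_lowerbound[OF gq]) auto
    ultimately have "q > 0" by simp
    then have "\<forall>\<^sub>F t in at_top. (g t)\<^sup>2 > q / 2" by (intro order_tendstoD[OF gq]) simp
    then obtain S where S: "\<And>t. t \<ge> S \<Longrightarrow> (g t)\<^sup>2 > q / 2"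
      unfolding eventually_at_top_linorder by blast
    define s where "s = max S T"
    \<comment> \<open>After this time span the loss \<open>q * (t - s)\<close> equals
      \<open>E s + 1\<close>, more than the available energy.\<close>
    define t where "t = s + (E s + 1) / q"
    have "s \<le> t" using \<open>q > 0\<close> by (simp add: t_def E_def)
    then have "(\<lambda>t. E t + q * t) t \<le> (\<lambda>t. E t + q * t) s"
    proof (rule DERIV_nonpos_imp_nonincreasing)
      fix r assume r: "s \<le> r" "r \<le> t"
      then have "T \<le> r" "S \<le> r" by (auto simp: s_def)
      have "q = 2 * (q / 2)" by simp
      also have "\<dots> \<le> \<kappa> * r\<^sup>2 * (g r)\<^sup>2"
        using kt[OF \<open>T \<le> r\<close>] S[OF \<open>S \<le> r\<close>] \<open>q > 0\<close> by (intro mult_mono) auto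
      finally have "2 * damping \<kappa> r * (g r)\<^sup>2 + q \<le> 0"
        using E_rate[OF \<open>T \<le> r\<close>] by simp
      moreover have "((\<lambda>t. E t + q * t) has_real_derivative 2 * damping \<kappa> r * (g r)\<^sup>2 + q) (at r)"
        by (rule derivative_eq_intros dE[OF \<open>T \<le> r\<close>] refl)+ simp
      ultimately show "\<exists>y. ((\<lambda>t. E t + q * t) has_real_derivative y) (at r) \<and> y \<le> 0" by blast
    qed
    moreover have "q * t = q * s + E s + 1" using \<open>q > 0\<close> by (simp add: t_def field_simps)
    moreover have "E t \<ge> 0" by (simp add: E_def)
    ultimately show False by simp
  qed
  show thesis
  proof (rule that[OF fL])
    show "(g \<longlongrightarrow> 0) at_top"
      using tendsto_real_sqrt[OF gq] \<open>q = 0\<close> by (simp add: tendsto_rabs_zero_iff)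
    \<comment> \<open>Since \<open>H\<close> increases and stays below \<open>f\<close>, its value
      at \<open>T\<close> bounds all later values of \<open>f\<close> from below.\<close>
    have "H T \<le> L"
    proof (rule tendsto_lowerbound[OF fL])
      show "\<forall>\<^sub>F t in at_top. H T \<le> f t"
        using eventually_ge_at_top[of T]
        by eventually_elim (meson H_increasing H_le order.refl order_trans)
    qed simp
    then show "L \<ge> f T - ((f T)\<^sup>2 + (g T)\<^sup>2) / 4 - \<alpha>\<^sup>2 / (\<kappa> * T)"
      by (simp add: H_def E_def)
  qed
qed

lemma wave_system_prescribed_limit:
  assumes "\<kappa> > 0" and sys: "wave_system \<kappa> \<alpha> f1 g1" "wave_system \<kappa> \<alpha> f2 g2"
    and W0: "f1 0 * g2 0 - f2 0 * g1 0 \<noteq> 0"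
  obtains a b where "((\<lambda>t. a * f1 t + b * f2 t) \<longlongrightarrow> c) at_top"
    "((\<lambda>t. a * g1 t + b * g2 t) \<longlongrightarrow> 0) at_top"
proof -
  \<comment> \<open>The bounds 1 and \<open>2 / \<kappa>\<close> ensure
    \<open>\<kappa> * T\<^sup>2 \<ge> 2\<close>; the third makes
    \<open>\<alpha>\<^sup>2 / (\<kappa> * T)\<close> at most 1/4. With \<open>f T = 1\<close> and
    \<open>g T = 0\<close> the limit is then at least 1 - 1/4 - 1/4 = 1/2.\<close>
  define T where "T = max (max 1 (2 / \<kappa>)) (4 * (\<alpha>\<^sup>2 / \<kappa>))"
  have T: "T \<ge> 1" "T \<ge> 2 / \<kappa>" "T \<ge> 4 * (\<alpha>\<^sup>2 / \<kappa>)" by (auto simp: T_def)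
  then have "T > 0" by simp
  have "T \<le> T\<^sup>2" using T(1) by (simp add: self_le_power)
  then have "2 / \<kappa> \<le> T\<^sup>2" using T(2) by simp
  then have kT: "\<kappa> * T\<^sup>2 \<ge> 2" using \<open>\<kappa> > 0\<close> by (simp add: field_simps)
  define W where "W = f1 T * g2 T - f2 T * g1 T"
  have "W \<noteq> 0" unfolding W_def using \<open>T > 0\<close> by (intro wronskian_nonzero[OF sys W0]) simp
  \<comment> \<open>Cramer's rule for the data (1, 0) at time \<open>T\<close>.\<close>
  define a b where "a = g2 T / W" and "b = - g1 T / W"
  define f g where "f = (\<lambda>t. a * f1 t + b * f2 t)" and "g = (\<lambda>t. a * g1 t + b * g2 t)"
  have "wave_system \<kappa> \<alpha> f g" unfolding f_def g_def by (rule wave_system_combination[OF sys])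
  then obtain L where L: "(f \<longlongrightarrow> L) at_top" "(g \<longlongrightarrow> 0) at_top"
    "L \<ge> f T - ((f T)\<^sup>2 + (g T)\<^sup>2) / 4 - \<alpha>\<^sup>2 / (\<kappa> * T)"
    using \<open>T > 0\<close> kT by (rule wave_system_asymptotics)
  have "f T = W / W" by (simp add: f_def a_def b_def W_def field_simps flip: diff_divide_distrib)
  then have "f T = 1" using \<open>W \<noteq> 0\<close> by simp
  moreover have "g T = 0" by (simp add: g_def a_def b_def)
  moreover have "\<alpha>\<^sup>2 / (\<kappa> * T) \<le> 1 / 4"
    using T(3) \<open>\<kappa> > 0\<close> \<open>T > 0\<close> by (simp add: field_simps)
  ultimately have "L \<noteq> 0" using L(3) by auto
  show thesis
  proof
    show "((\<lambda>t. c / L * a * f1 t + c / L * b * f2 t) \<longlongrightarrow> c) at_top"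
      using tendsto_mult_left[OF L(1), of "c / L"] \<open>L \<noteq> 0\<close>
      by (simp add: f_def algebra_simps)
    show "((\<lambda>t. c / L * a * g1 t + c / L * b * g2 t) \<longlongrightarrow> 0) at_top"
      using tendsto_mult_left[OF L(2), of "c / L"]
      by (simp add: g_def algebra_simps)
  qed
qed

section \<open>Smoothness of the fields and the pressure\<close>

lemma Ck_on_Pair:
  assumes "Ck_on k S u" "Ck_on k S v"
  shows "Ck_on k S (\<lambda>z. (u z, v z))"
  using assms
proof (induction k arbitrary: u v)
  case 0
  then show ?case by (simp add: continuous_on_Pair)
next
  case (Suc k)
  then obtain u' v' where
    "\<And>z. z \<in> S \<Longrightarrow> (u has_derivative u' z) (at z within S)" "\<And>w. Ck_on k S (\<lambda>z. u' z w)"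
    "\<And>z. z \<in> S \<Longrightarrow> (v has_derivative v' z) (at z within S)" "\<And>w. Ck_on k S (\<lambda>z. v' z w)"
    unfolding Ck_on.simps by blast
  then show ?case
    by (auto intro!: exI[of _ "\<lambda>z w. (u' z w, v' z w)"] has_derivative_Pair Suc.IH)
qed

lemma smooth_on_Pair:
  "smooth_on S u \<Longrightarrow> smooth_on S v \<Longrightarrow> smooth_on S (\<lambda>z. (u z, v z))"
  by (simp add: smooth_on_def Ck_on_Pair)

text \<open>Directional derivatives stay in \<open>F\<close>, so induction on \<open>k\<close> over
  all members at once gives every order of regularity without computing higher derivatives.\<close>

lemma smooth_on_if_closed_under_derivatives:
  assumes closed: "\<And>u. u \<in> F \<Longrightarrow>
      \<exists>u'. (\<forall>z\<in>S. (u has_derivative u' z) (at z within S)) \<and> (\<forall>v. (\<lambda>z. u' z v) \<in> F)"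
    and "u \<in> F"
  shows "smooth_on S u"
proof -
  have "Ck_on k S u" for k
    using \<open>u \<in> F\<close>
  proof (induction k arbitrary: u)
    case 0
    then show ?case
      using closed by (fastforce simp: continuous_on_eq_continuous_within dest: has_derivative_continuous)
  next
    case (Suc k)
    then show ?case using closed[of u] by fastforce
  qed
  then show ?thesis by (simp add: smooth_on_def)
qed

text \<open>A class of functions that contains the fields and the pressure and is closed under
  differentiation by virtue of the system for \<open>f\<close> and \<open>g\<close>.\<close>

inductive_set wave_algebra :: "(real \<Rightarrow> real) \<Rightarrow> (real \<Rightarrow> real) \<Rightarrow> (real \<times> real \<times> real \<Rightarrow> real) set"
  for f g :: "real \<Rightarrow> real" where
  const: "(\<lambda>_. c) \<in> wave_algebra f g"
| time: "(\<lambda>z. fst z) \<in> wave_algebra f g"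
| x: "(\<lambda>z. fst (snd z)) \<in> wave_algebra f g"
| y: "(\<lambda>z. snd (snd z)) \<in> wave_algebra f g"
| f: "(\<lambda>z. f (fst z)) \<in> wave_algebra f g"
| g: "(\<lambda>z. g (fst z)) \<in> wave_algebra f g"
| weight: "(\<lambda>z. inverse (1 + (fst z)\<^sup>2)) \<in> wave_algebra f g"
| cos: "(\<lambda>z. cos (fst (snd z) - fst z * snd (snd z))) \<in> wave_algebra f g"
| sin: "(\<lambda>z. sin (fst (snd z) - fst z * snd (snd z))) \<in> wave_algebra f g"
| add: "u \<in> wave_algebra f g \<Longrightarrow> v \<in> wave_algebra f g \<Longrightarrow> (\<lambda>z. u z + v z) \<in> wave_algebra f g"
| mult: "u \<in> wave_algebra f g \<Longrightarrow> v \<in> wave_algebra f g \<Longrightarrow> (\<lambda>z. u z * v z) \<in> wave_algebra f g"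

lemma wave_algebra_minus: "u \<in> wave_algebra f g \<Longrightarrow> (\<lambda>z. - u z) \<in> wave_algebra f g"
  using wave_algebra.mult[OF wave_algebra.const[where c="-1"]] by simp

lemma wave_algebra_diff:
  "u \<in> wave_algebra f g \<Longrightarrow> v \<in> wave_algebra f g \<Longrightarrow> (\<lambda>z. u z - v z) \<in> wave_algebra f g"
  using wave_algebra.add[OF _ wave_algebra_minus] by simp

lemma wave_algebra_power: "u \<in> wave_algebra f g \<Longrightarrow> (\<lambda>z. u z ^ n) \<in> wave_algebra f g"
  by (induction n) (simp_all add: wave_algebra.const wave_algebra.mult)

lemma wave_algebra_divide_weight:
  "u \<in> wave_algebra f g \<Longrightarrow> (\<lambda>z. u z / (1 + (fst z)\<^sup>2)) \<in> wave_algebra f g"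
  using wave_algebra.mult[OF _ wave_algebra.weight] by (simp add: divide_inverse)

lemmas wave_algebra_intros = wave_algebra.intros wave_algebra_minus wave_algebra_diff
  wave_algebra_power wave_algebra_divide_weight

text \<open>Allows the one-sided time derivatives of \<open>f\<close> and \<open>g\<close> at 0 to
  be used for functions on space-time: the time projection of \<open>S\<close> lies in
  \<open>T\<close>.\<close>

lemma has_derivative_compose_fst:
  fixes h :: "real \<Rightarrow> real"
  assumes "(h has_real_derivative d) (at (fst z) within T)" and "S \<subseteq> T \<times> UNIV"
  shows "((\<lambda>z. h (fst z)) has_derivative (\<lambda>v. d * fst v)) (at z within S)"
proof -
  have "(h has_derivative (*) d) (at (fst z) within fst ` S)"
    unfolding has_field_derivative_def[symmetric]
    using assms by (intro has_field_derivative_subset[OF assms(1)]) auto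
  from has_derivative_in_compose[OF has_derivative_fst[OF has_derivative_ident] this]
  show ?thesis by simp
qed

text \<open>Rule induction. The derivatives of \<open>f\<close> and \<open>g\<close> re-enter the
  class through the system, since \<open>damping\<close> is built from time and the weight; the
  derivative of the weight is \<open>- 2 * t\<close> times its square.\<close>

lemma wave_algebra_derivative:
  assumes sys: "wave_system \<kappa> \<alpha> f g" and "u \<in> wave_algebra f g"
  shows "\<exists>u'. (\<forall>z\<in>{0..} \<times> UNIV. (u has_derivative u' z) (at z within {0..} \<times> UNIV)) \<and>
      (\<forall>v. (\<lambda>z. u' z v) \<in> wave_algebra f g)"
  using assms(2)
proof induction
  case (const c)
  show ?case
    by (intro exI[of _ "\<lambda>z v. 0"] conjI ballI allI wave_algebra_intros)
      (auto intro!: derivative_eq_intros)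
next
  case time
  show ?case
    by (intro exI[of _ "\<lambda>z v. fst v"] conjI ballI allI wave_algebra_intros)
      (auto intro!: derivative_eq_intros)
next
  case x
  show ?case
    by (intro exI[of _ "\<lambda>z v. fst (snd v)"] conjI ballI allI wave_algebra_intros)
      (auto intro!: derivative_eq_intros)
next
  case y
  show ?case
    by (intro exI[of _ "\<lambda>z v. snd (snd v)"] conjI ballI allI wave_algebra_intros)
      (auto intro!: derivative_eq_intros)
next
  case f
  show ?case
    using sys
    by (intro exI[of _ "\<lambda>z v. - \<alpha> * g (fst z) * fst v"] conjI ballI allI wave_algebra_intros
        has_derivative_compose_fst[where T="{0..}"])
      (auto simp: wave_system_def)
next
  case g
  show ?case
    using sys unfolding damping_def wave_system_def
    by (intro exI[of _ "\<lambda>z v. (\<alpha> * f (fst z) + (2 * fst z / (1 + (fst z)\<^sup>2) - \<kappa> * (1 + (fst z)\<^sup>2)) * g (fst z)) * fst v"]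
        conjI ballI allI wave_algebra_intros has_derivative_compose_fst[where T="{0..}"])
      auto
next
  case weight
  have "((\<lambda>t. inverse (1 + t\<^sup>2)) has_real_derivative
      - (2 * t) * (inverse (1 + t\<^sup>2))\<^sup>2) (at t within {0..})" for t :: real
    by (rule derivative_eq_intros one_plus_square_neq_0 refl)+ (simp add: power2_eq_square)
  then show ?case
    by (intro exI[of _ "\<lambda>z v. - (2 * fst z) * (inverse (1 + (fst z)\<^sup>2))\<^sup>2 * fst v"]
        conjI ballI allI wave_algebra_intros has_derivative_compose_fst[where T="{0..}"])
      auto
next
  case cos
  show ?case
    by (intro exI[of _ "\<lambda>z v. (fst (snd v) - (fst z * snd (snd v) + fst v * snd (snd z))) *
          - sin (fst (snd z) - fst z * snd (snd z))"]
        conjI ballI allI wave_algebra_intros)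
      (rule derivative_eq_intros refl | simp)+
next
  case sin
  show ?case
    by (intro exI[of _ "\<lambda>z v. (fst (snd v) - (fst z * snd (snd v) + fst v * snd (snd z))) *
          cos (fst (snd z) - fst z * snd (snd z))"]
        conjI ballI allI wave_algebra_intros)
      (rule derivative_eq_intros refl | simp)+
next
  case (add u v)
  then obtain u' v' where
    "\<And>z. z \<in> {0..} \<times> UNIV \<Longrightarrow> (u has_derivative u' z) (at z within {0..} \<times> UNIV)"
    "\<And>w. (\<lambda>z. u' z w) \<in> wave_algebra f g"
    "\<And>z. z \<in> {0..} \<times> UNIV \<Longrightarrow> (v has_derivative v' z) (at z within {0..} \<times> UNIV)"
    "\<And>w. (\<lambda>z. v' z w) \<in> wave_algebra f g"
    by blast
  then show ?case
    by (intro exI[of _ "\<lambda>z w. u' z w + v' z w"] conjI ballI allI wave_algebra.add has_derivative_add)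
next
  case (mult u v)
  then obtain u' v' where
    "\<And>z. z \<in> {0..} \<times> UNIV \<Longrightarrow> (u has_derivative u' z) (at z within {0..} \<times> UNIV)"
    "\<And>w. (\<lambda>z. u' z w) \<in> wave_algebra f g"
    "\<And>z. z \<in> {0..} \<times> UNIV \<Longrightarrow> (v has_derivative v' z) (at z within {0..} \<times> UNIV)"
    "\<And>w. (\<lambda>z. v' z w) \<in> wave_algebra f g"
    by blast
  with mult.hyps show ?case
    by (intro exI[of _ "\<lambda>z w. u z * v' z w + u' z w * v z"] conjI ballI allI
        wave_algebra.add wave_algebra.mult has_derivative_mult)
qed

lemma smooth_on_wave_algebra:
  assumes "wave_system \<kappa> \<alpha> f g" and "u \<in> wave_algebra f g"
  shows "smooth_on ({0..} \<times> UNIV) u"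
  using wave_algebra_derivative[OF assms(1)] assms(2) by (rule smooth_on_if_closed_under_derivatives)

section \<open>Waves with a single phase and the MHD equations\<close>

text \<open>A normal form stable under both spatial derivatives, which act on the coefficients
  alone. It turns the differential equations into algebraic identities in the coefficients, cosine
  and sine.\<close>

definition shear_wave :: "real \<Rightarrow> real \<Rightarrow> real \<Rightarrow> real \<Rightarrow> real \<Rightarrow> real \<times> real \<Rightarrow> real" where
  "shear_wave t c d A B = (\<lambda>(x, y). c + d * y + A * cos (x - t * y) + B * sin (x - t * y))"

lemma shear_wave_deriv_x:
  "((\<lambda>x. shear_wave t c d A B (x, y)) has_vector_derivative shear_wave t 0 0 B (- A) (x, y)) (at x)"
  unfolding shear_wave_def has_real_derivative_iff_has_vector_derivative[symmetric]
  by (auto intro!: derivative_eq_intros)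

lemma shear_wave_deriv_y:
  "((\<lambda>y. shear_wave t c d A B (x, y)) has_vector_derivative
      shear_wave t d 0 (- (t * B)) (t * A) (x, y)) (at y)"
  unfolding shear_wave_def has_real_derivative_iff_has_vector_derivative[symmetric]
  by (auto intro!: derivative_eq_intros simp: algebra_simps)

lemma partial_shear_wave:
  "partial_x (shear_wave t c d A B) = shear_wave t 0 0 B (- A)"
  "partial_y (shear_wave t c d A B) = shear_wave t d 0 (- (t * B)) (t * A)"
  by (simp_all add: fun_eq_iff partial_x_def partial_y_def
      vector_derivative_at[OF shear_wave_deriv_x] vector_derivative_at[OF shear_wave_deriv_y])

text \<open>Advection and the Laplacian differentiate the vector field as a whole, so the
  coefficient rules are needed for pairs as well.\<close>

lemma partial_shear_wave_pair:
  "partial_x (\<lambda>z. (shear_wave t c d A B z, shear_wave t c' d' A' B' z))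
    = (\<lambda>z. (shear_wave t 0 0 B (- A) z, shear_wave t 0 0 B' (- A') z))"
  "partial_y (\<lambda>z. (shear_wave t c d A B z, shear_wave t c' d' A' B' z))
    = (\<lambda>z. (shear_wave t d 0 (- (t * B)) (t * A) z, shear_wave t d' 0 (- (t * B')) (t * A') z))"
  by (simp_all add: fun_eq_iff partial_x_def partial_y_def
      vector_derivative_at[OF has_vector_derivative_Pair[OF shear_wave_deriv_x shear_wave_deriv_x]]
      vector_derivative_at[OF has_vector_derivative_Pair[OF shear_wave_deriv_y shear_wave_deriv_y]])

lemma wave_velocity_eq:
  "wave_velocity f t = (\<lambda>z. (shear_wave t 0 1 0 (t * (f t / (1 + t\<^sup>2))) z,
      shear_wave t 0 0 0 (f t / (1 + t\<^sup>2)) z))"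
proof -
  have "(\<lambda>(x, y). cos (x - t * y)) = shear_wave t 0 0 1 0"
    by (simp add: shear_wave_def)
  then show ?thesis
    by (simp add: wave_velocity_def perp_grad_def partial_shear_wave fun_eq_iff)
      (simp add: shear_wave_def)
qed

lemma wave_magnetic_eq:
  "wave_magnetic \<alpha> g t = (\<lambda>z. (shear_wave t \<alpha> 0 (t * (g t / (1 + t\<^sup>2))) 0 z,
      shear_wave t 0 0 (g t / (1 + t\<^sup>2)) 0 z))"
proof -
  have "(\<lambda>(x, y). sin (x - t * y)) = shear_wave t 0 0 0 1"
    by (simp add: shear_wave_def)
  then show ?thesis
    by (simp add: wave_magnetic_def perp_grad_def partial_shear_wave fun_eq_iff)
      (simp add: shear_wave_def)
qed

text \<open>The pressure balances the part of the momentum equation along \<open>(1, - t)\<close>; the part along \<open>(t, 1)\<close>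
  is the equation for \<open>f\<close>.\<close>

definition wave_pressure :: "(real \<Rightarrow> real) \<Rightarrow> real \<Rightarrow> real \<times> real \<Rightarrow> real" where
  "wave_pressure f t = shear_wave t 0 0 (2 * f t / (1 + t\<^sup>2)\<^sup>2) 0"

lemma periodic_x_shear_wave: "periodic_x (shear_wave t c d A B)"
proof -
  have "x + 2 * pi - t * y = (x - t * y) + 2 * pi" for x y :: real by simp
  then show ?thesis
    unfolding periodic_x_def shear_wave_def by (simp only: prod.case cos_periodic sin_periodic) simp
qed

lemma wave_mhd_solution:
  assumes sys: "wave_system \<kappa> \<alpha> f g"
  shows "smooth_global_mhd_solution \<kappa> (wave_velocity f) (wave_magnetic \<alpha> g) (wave_pressure f)"
  unfolding smooth_global_mhd_solution_def
proof (intro conjI allI impI)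
  show "smooth_on ({0..} \<times> UNIV) (\<lambda>(t, z). wave_velocity f t z)"
    "smooth_on ({0..} \<times> UNIV) (\<lambda>(t, z). wave_magnetic \<alpha> g t z)"
    "smooth_on ({0..} \<times> UNIV) (\<lambda>(t, z). wave_pressure f t z)"
    \<comment> \<open>The squared weight in the pressure is split into two successive divisions,
      each of which the class admits.\<close>
    unfolding wave_velocity_eq wave_magnetic_eq wave_pressure_def shear_wave_def case_prod_beta
      power2_eq_square[of "1 + _\<^sup>2"] divide_divide_eq_left[symmetric]
    by (intro smooth_on_Pair smooth_on_wave_algebra[OF sys] wave_algebra_intros)+
next
  fix t :: real assume "t \<ge> 0"
  show "periodic_x (wave_velocity f t)" "periodic_x (wave_magnetic \<alpha> g t)"
    "periodic_x (wave_pressure f t)"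
    using periodic_x_shear_wave
    by (auto simp: wave_velocity_eq wave_magnetic_eq wave_pressure_def periodic_x_def)
next
  fix t :: real and z :: "real \<times> real" assume t: "t \<ge> 0"
  obtain x y where z: "z = (x, y)" by force
  define a b where "a = (\<lambda>t. f t / (1 + t\<^sup>2))" and "b = (\<lambda>t. g t / (1 + t\<^sup>2))"
  \<comment> \<open>Expressing \<open>a t\<close> as \<open>q * (1 + t\<^sup>2)\<close> removes all
    fractions from the momentum equation.\<close>
  define q where "q = f t / (1 + t\<^sup>2)\<^sup>2"
  have split: "u / w = u / w\<^sup>2 * w" if "w \<noteq> 0" for u w :: real
    using that by (simp add: power2_eq_square)
  have a: "a t = q * (1 + t\<^sup>2)"
    unfolding a_def q_def by (rule split[OF one_plus_square_neq_0])
  have V: "wave_velocity f = (\<lambda>t z. (shear_wave t 0 1 0 (t * a t) z, shear_wave t 0 0 0 (a t) z))"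
    and B: "wave_magnetic \<alpha> g = (\<lambda>t z. (shear_wave t \<alpha> 0 (t * b t) 0 z, shear_wave t 0 0 (b t) 0 z))"
    by (simp_all add: fun_eq_iff wave_velocity_eq wave_magnetic_eq a_def b_def)
  have p: "wave_pressure f t = shear_wave t 0 0 (2 * q) 0"
    by (simp add: wave_pressure_def q_def)
  note d = sys[unfolded wave_system_def, rule_format, OF t]
  have da [derivative_intros]: "(a has_real_derivative - \<alpha> * b t - 2 * t * q) (at t within {0..})"
  proof -
    \<comment> \<open>Here \<open>w\<close> stands for \<open>1 + t\<^sup>2\<close>, kept as an atom
      while denominators are cleared.\<close>
    have "(- \<alpha> * g t * w - f t * (2 * t)) / (w * w) = - \<alpha> * (g t / w) - 2 * t * (f t / w\<^sup>2)"
      if "w \<noteq> 0" for w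
      using that by (simp add: field_simps power2_eq_square)
    then show ?thesis
      unfolding a_def b_def q_def
      by - (rule derivative_eq_intros d[THEN conjunct1] one_plus_square_neq_0 refl | simp)+
  qed
  \<comment> \<open>Differentiating the weight cancels the growth term of \<open>damping\<close>,
    leaving pure resistive decay and the coupling.\<close>
  have db [derivative_intros]: "(b has_real_derivative \<alpha> * a t - \<kappa> * (1 + t\<^sup>2) * b t) (at t within {0..})"
  proof -
    have "((\<alpha> * f t + (2 * t / w - \<kappa> * w) * g t) * w - g t * (2 * t)) / (w * w)
        = \<alpha> * (f t / w) - \<kappa> * w * (g t / w)"
      if "w \<noteq> 0" for w
      using that by (simp add: field_simps power2_eq_square)
    then show ?thesis
      unfolding a_def b_def
      by - (rule derivative_eq_intros d[THEN conjunct2] one_plus_square_neq_0 refl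
          | simp add: damping_def)+
  qed
  \<comment> \<open>Needed for uniqueness of the time derivative, which is one-sided at
    \<open>t = 0\<close>.\<close>
  have nontrivial: "at t within {0..} \<noteq> bot"
  proof -
    have "at_right t \<le> at t within {0..}" using t by (intro at_le) auto
    then show ?thesis using trivial_limit_at_right_real[of t] by (metis bot.extremum_uniqueI)
  qed
  define C S where "C = cos (x - t * y)" and "S = sin (x - t * y)"
  have dt_V: "partial_t (wave_velocity f) t (x, y) =
      (a t * S + t * (- \<alpha> * b t - 2 * t * q) * S - t * a t * y * C,
       (- \<alpha> * b t - 2 * t * q) * S - a t * y * C)"
    unfolding partial_t_def V shear_wave_def prod.case C_def S_def
    by (intro vector_derivative_within[OF nontrivial] has_vector_derivative_Pair
        has_real_derivative_iff_has_vector_derivative[THEN iffD1])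
      ((rule derivative_eq_intros refl)+, simp add: algebra_simps)+
  have dt_B: "partial_t (wave_magnetic \<alpha> g) t (x, y) =
      (b t * C + t * (\<alpha> * a t - \<kappa> * (1 + t\<^sup>2) * b t) * C + t * b t * y * S,
       (\<alpha> * a t - \<kappa> * (1 + t\<^sup>2) * b t) * C + b t * y * S)"
    unfolding partial_t_def B shear_wave_def prod.case C_def S_def
    by (intro vector_derivative_within[OF nontrivial] has_vector_derivative_Pair
        has_real_derivative_iff_has_vector_derivative[THEN iffD1])
      ((rule derivative_eq_intros refl)+, simp add: algebra_simps)+
  have sw: "shear_wave t c d A B (x, y) = c + d * y + A * C + B * S" for c d A B
    by (simp add: shear_wave_def C_def S_def)
  \<comment> \<open>The quadratic wave terms cancel, and transport by the shear cancels the time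
    derivative of the phase. What remains besides the \<alpha> terms is \<open>2 * q * S\<close>
    times (1, -t), the negative of the pressure gradient.\<close>
  show "partial_t (wave_velocity f) t z + advect (wave_velocity f t) (wave_velocity f t) z
      + grad (wave_pressure f t) z = advect (wave_magnetic \<alpha> g t) (wave_magnetic \<alpha> g t) z"
    unfolding z dt_V p unfolding V B
    by (simp add: advect_def grad_def partial_shear_wave partial_shear_wave_pair sw a
        algebra_simps power2_eq_square)
  show "partial_t (wave_magnetic \<alpha> g) t z + advect (wave_velocity f t) (wave_magnetic \<alpha> g t) z
      = \<kappa> *\<^sub>R laplacian (wave_magnetic \<alpha> g t) z + advect (wave_magnetic \<alpha> g t) (wave_velocity f t) z"
    unfolding z dt_B unfolding V B
    by (simp add: advect_def laplacian_def partial_shear_wave_pair sw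
        algebra_simps power2_eq_square)
  show "divergence (wave_magnetic \<alpha> g t) z = 0" "divergence (wave_velocity f t) z = 0"
    unfolding z V B by (simp_all add: divergence_def partial_shear_wave sw)
qed

theorem lemma2:
  fixes \<kappa> \<alpha> :: real
  assumes "\<kappa> > 0"
  shows "\<exists>(f :: real \<times> real \<Rightarrow> real \<Rightarrow> real) (g :: real \<times> real \<Rightarrow> real \<Rightarrow> real)
            (p :: real \<times> real \<Rightarrow> real \<Rightarrow> real \<times> real \<Rightarrow> real).
           (\<forall>f0 g0.
              smooth_global_mhd_solution \<kappa>
                (wave_velocity (f (f0, g0))) (wave_magnetic \<alpha> (g (f0, g0))) (p (f0, g0)) \<and>
              f (f0, g0) 0 = f0 \<and> g (f0, g0) 0 = g0) \<and>
           (\<forall>c::real. \<exists>f0 g0.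
              (f (f0, g0) \<longlongrightarrow> 2 * c) at_top \<and> (g (f0, g0) \<longlongrightarrow> 0) at_top)"
proof -
  \<comment> \<open>Solutions with unit initial data have Wronskian 1 at time 0, and the
    coefficients of a combination of them are its initial data. The coefficients found for a
    prescribed limit thus serve as \<open>f0\<close> and \<open>g0\<close>.\<close>
  obtain f1 g1 where 1: "wave_system \<kappa> \<alpha> f1 g1" "f1 0 = 1" "g1 0 = 0"
    by (rule wave_system_exists)
  obtain f2 g2 where 2: "wave_system \<kappa> \<alpha> f2 g2" "f2 0 = 0" "g2 0 = 1"
    by (rule wave_system_exists)
  define f where "f = (\<lambda>(f0, g0) t. f0 * f1 t + g0 * f2 t)"
  define g where "g = (\<lambda>(f0, g0) t. f0 * g1 t + g0 * g2 t)"
  have "wave_system \<kappa> \<alpha> (f (f0, g0)) (g (f0, g0))" for f0 g0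
    unfolding f_def g_def prod.case using 1(1) 2(1) by (rule wave_system_combination)
  then have "smooth_global_mhd_solution \<kappa> (wave_velocity (f (f0, g0)))
      (wave_magnetic \<alpha> (g (f0, g0))) (wave_pressure (f (f0, g0)))" for f0 g0
    by (rule wave_mhd_solution)
  moreover have "f (f0, g0) 0 = f0 \<and> g (f0, g0) 0 = g0" for f0 g0
    by (simp add: f_def g_def 1 2)
  moreover have "\<exists>f0 g0. (f (f0, g0) \<longlongrightarrow> 2 * c) at_top \<and> (g (f0, g0) \<longlongrightarrow> 0) at_top" for c
    using wave_system_prescribed_limit[OF assms 1(1) 2(1), of "2 * c"]
    by (simp add: f_def g_def 1 2) metis
  ultimately show ?thesis
    by (intro exI[of _ f] exI[of _ g] exI[of _ "\<lambda>i. wave_pressure (f i)"]) blast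
qed

end
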